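(* Let $\mathcal{E}\subseteq\mathbb{C}^{n\times n}$ be a nonempty closed set. For almost every $A\in\mathbb{R}^{n\times n}$ (with respect to Lebesgue measure on $\mathbb{R}^{n\times n}$), precisely one of the following statements holds: 1. There is a unique matrix in $\mathcal{E}$ nearest to $A$, and it is real. 2. All the matrices in $\mathcal{E}$ nearest to $A$ are nonreal. If, in addition, $\mathcal{E}$ is invariant under complex conjugation ($X\in\mathcal{E}\Rightarrow\overline{X}\in\mathcal{E}$) and $\mathcal{E}\cap\mathbb{R}^{n\times n}\neq\varnothing$, then in the second case there are in $\mathcal{E}$ at least two distinct matrices nearest to $A$.
   Context: Distances are in the Frobenius norm $\|\cdot\|_F$: a matrix $B\in\mathcal{E}$ is nearest to $A$ if $\|A-B\|_F=\min_{X\in\mathcal{E}}\|A-X\|_F$. $\overline{X}$ is the elementwise complex conjugate of $X$. A matrix is real if all its entries are real, and nonreal otherwise. *)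

theory Defs
  imports "HOL-Analysis.Analysis"
begin

definition frobenius_norm :: "complex^'n^'m \<Rightarrow> real" where
  "frobenius_norm A = sqrt (\<Sum>i\<in>UNIV. \<Sum>j\<in>UNIV. (cmod (A $ i $ j))\<^sup>2)"

text \<open>The Frobenius norm is the library norm on matrices regarded as vectors of vectors,
  so closedness with respect to it is the library predicate \<^const>\<open>closed\<close>.\<close>

lemma frobenius_norm_eq_norm: "frobenius_norm A = norm A"
  by (simp add: frobenius_norm_def norm_vec_def L2_set_def sum_nonneg)

definition real_matrix :: "complex^'n^'m \<Rightarrow> bool" where
  "real_matrix A \<longleftrightarrow> (\<forall>i j. A $ i $ j \<in> \<real>)"

definition nearest_matrix ::
    "(complex^'n^'m) set \<Rightarrow> complex^'n^'m \<Rightarrow> complex^'n^'m \<Rightarrow> bool" where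
  "nearest_matrix \<E> A B \<longleftrightarrow>
     B \<in> \<E> \<and> (\<forall>X\<in>\<E>. frobenius_norm (A - B) \<le> frobenius_norm (A - X))"

definition unique_nearest_real :: "(complex^'n^'m) set \<Rightarrow> complex^'n^'m \<Rightarrow> bool" where
  "unique_nearest_real \<E> A \<longleftrightarrow>
     (\<exists>B. nearest_matrix \<E> A B \<and> (\<forall>C. nearest_matrix \<E> A C \<longrightarrow> C = B) \<and> real_matrix B)"

definition all_nearest_nonreal :: "(complex^'n^'m) set \<Rightarrow> complex^'n^'m \<Rightarrow> bool" where
  "all_nearest_nonreal \<E> A \<longleftrightarrow> (\<forall>B. nearest_matrix \<E> A B \<longrightarrow> \<not> real_matrix B)"

end

theory Submission
  imports Defs
begin

text \<open>
  Let \<open>L\<close> be the embedding of the real matrices. If \<open>x\<close> and \<open>y\<close> in \<open>\<E>\<close> are nearest to \<open>L a\<close> and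
  to \<open>L a + t L e\<close> with \<open>t > 0\<close>, respectively, then expanding the squared distances gives
  \<open>L e \<bullet> x \<le> L e \<bullet> y\<close>. Hence, for \<open>p < q\<close>, the closed set of all \<open>a\<close> that have nearest points both
  in the half-space \<open>L e \<bullet> x \<le> p\<close> and in the half-space \<open>L e \<bullet> x \<ge> q\<close> meets each line parallel to \<open>e\<close>
  at most once, and so it is negligible. Letting \<open>p\<close>, \<open>q\<close> range over the rationals and \<open>e\<close> over a
  basis shows that for almost every \<open>a\<close> all points nearest to \<open>L a\<close> differ by vectors orthogonal to
  the range of \<open>L\<close>. If one of them lies in the range, it is the unique one by Pythagoras.
\<close>

text \<open>The translates of \<open>T\<close> by \<open>e / (n + 1)\<close> are pairwise disjoint,
  have equal measure and stay in one bounded set. A constant series with finite sum has zero terms,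
  so \<open>T\<close> has measure zero.\<close>

lemma negligible_compact_disjoint_translates:
  fixes T :: "'a::euclidean_space set"
  assumes "compact T" and disj: "\<And>x t. x \<in> T \<Longrightarrow> t > 0 \<Longrightarrow> x + t *\<^sub>R e \<notin> T"
  shows "negligible T"
proof -
  define A where "A n = (+) ((1 / real (Suc n)) *\<^sub>R e) ` T" for n
  have lm: "A n \<in> lmeasurable" for n
    unfolding A_def by (intro measurable_translation lmeasurable_compact \<open>compact T\<close>)
  have "disjoint_family A"
  proof -
    have *: "x + s *\<^sub>R e \<noteq> y + t *\<^sub>R e" if "x \<in> T" "y \<in> T" "s < t" for x y s t
    proof
      assume "x + s *\<^sub>R e = y + t *\<^sub>R e"
      then have "x = y + (t - s) *\<^sub>R e" by (simp add: algebra_simps)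
      then show False using disj[of y "t - s"] that by simp
    qed
    have "A m \<inter> A n = {}" if "m < n" for m n
    proof -
      have "1 / real (Suc n) < 1 / real (Suc m)" using that by (simp add: field_simps)
      from *[OF _ _ this] show ?thesis
        unfolding A_def by (fastforce simp: add.commute)
    qed
    then show ?thesis
      unfolding disjoint_family_on_def by (metis Int_commute linorder_neqE_nat)
  qed
  moreover have "emeasure lebesgue (\<Union>n. A n) \<noteq> \<infinity>"
  proof -
    obtain M where M: "\<And>x. x \<in> T \<Longrightarrow> norm x \<le> M"
      using \<open>compact T\<close> compact_imp_bounded bounded_iff by metis
    \<comment> \<open>Every shift has length at most \<open>norm e\<close>.\<close>
    have "(\<Union>n. A n) \<subseteq> cball 0 (norm e + M)"
    proof clarsimp
      fix n y assume "y \<in> A n"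
      then obtain x where x: "x \<in> T" "y = (1 / real (Suc n)) *\<^sub>R e + x"
        unfolding A_def by blast
      have "norm ((1 / real (Suc n)) *\<^sub>R e) \<le> norm e"
        by (simp add: divide_le_eq mult_left_le_one_le algebra_simps)
      then show "norm y \<le> norm e + M"
        unfolding x(2) using M[OF x(1)] by (intro norm_triangle_le) linarith
    qed
    then have "bounded (\<Union>n. A n)"
      using bounded_subset bounded_cball by blast
    moreover have "(\<Union>n. A n) \<in> sets lebesgue"
      using lm by (intro sets.countable_UN) (auto simp: fmeasurableD)
    ultimately show ?thesis
      unfolding infinity_ennreal_def by (intro fmeasurableD2 bounded_set_imp_lmeasurable)
  qed
  ultimately have "(\<lambda>n. measure lebesgue (A n)) sums measure lebesgue (\<Union>n. A n)"
    using fmeasurableD[OF lm] by (intro measure_UNION image_subsetI)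
  then have "summable (\<lambda>n::nat. measure lebesgue T)"
    unfolding A_def measure_translation by (rule sums_summable)
  then show ?thesis
    by (simp add: negligible_iff_measure lmeasurable_compact[OF \<open>compact T\<close>] summable_const_iff)
qed

text \<open>Cutting with a box makes \<open>T\<close> compact, and the condition on translates
  passes to subsets.\<close>

lemma negligible_closed_disjoint_translates:
  fixes T :: "'a::euclidean_space set"
  assumes "closed T" and "\<And>x t. x \<in> T \<Longrightarrow> t > 0 \<Longrightarrow> x + t *\<^sub>R e \<notin> T"
  shows "negligible T"
proof (subst negligible_on_intervals, intro allI)
  fix a b
  show "negligible (T \<inter> cbox a b)"
  proof (rule negligible_compact_disjoint_translates)
    show "compact (T \<inter> cbox a b)"
      using \<open>closed T\<close> compact_cbox by (rule closed_Int_compact)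
    show "x + t *\<^sub>R e \<notin> T \<inter> cbox a b" if "x \<in> T \<inter> cbox a b" "t > 0" for x t
      using that assms(2)[of x t] by simp
  qed
qed

text \<open>Distances to a nonempty closed \<open>F\<close> are attained, so the condition says that
  the distances to \<open>F\<close> and to \<open>E\<close> agree; both depend continuously on
  \<open>a\<close>.\<close>

lemma closed_nearest_in_subset:
  fixes f :: "'a::t2_space \<Rightarrow> 'b::heine_borel"
  assumes "continuous_on UNIV f" "closed F" "F \<subseteq> E"
  shows "closed {a. \<exists>x\<in>F. dist (f a) x = infdist (f a) E}"
proof (cases "F = {}")
  case False
  have "(\<exists>x\<in>F. dist (f a) x = infdist (f a) E) \<longleftrightarrow> infdist (f a) F = infdist (f a) E" for a
    using infdist_attains_inf[OF \<open>closed F\<close> False, of "f a"] infdist_mono[OF \<open>F \<subseteq> E\<close> False]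
      infdist_le[of _ F "f a"]
    by (metis order_antisym)
  then show ?thesis
    using assms(1) by (simp add: closed_Collect_eq continuous_on_infdist)
qed simp

lemma inner_nearest_mono:
  fixes a v :: "'b::real_inner"
  assumes "x \<in> E" "dist a x = infdist a E"
    and "y \<in> E" "dist (a + t *\<^sub>R v) y = infdist (a + t *\<^sub>R v) E" and "t > 0"
  shows "v \<bullet> x \<le> v \<bullet> y"
proof -
  have "norm (a - x) \<le> norm (a - y)" "norm (a + t *\<^sub>R v - y) \<le> norm (a + t *\<^sub>R v - x)"
    using assms infdist_le[of y E a] infdist_le[of x E "a + t *\<^sub>R v"] by (simp_all add: dist_norm)
  then have "(a - x) \<bullet> (a - x) \<le> (a - y) \<bullet> (a - y)"
    "(a + t *\<^sub>R v - y) \<bullet> (a + t *\<^sub>R v - y) \<le> (a + t *\<^sub>R v - x) \<bullet> (a + t *\<^sub>R v - x)"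
    by (simp_all add: norm_le)
  \<comment> \<open>Adding the two inequalities cancels everything but the cross terms with
    \<open>t *\<^sub>R v\<close>.\<close>
  then have "t * (v \<bullet> x) \<le> t * (v \<bullet> y)"
    by (simp add: algebra_simps inner_commute)
  then show ?thesis using \<open>t > 0\<close> by simp
qed

lemma AE_nearest_inner_range_eq:
  fixes L :: "'a::euclidean_space \<Rightarrow> 'b::euclidean_space"
  assumes "linear L" "closed E"
  shows "AE a in lebesgue. \<forall>x\<in>E. \<forall>y\<in>E. dist (L a) x = infdist (L a) E \<longrightarrow>
           dist (L a) y = infdist (L a) E \<longrightarrow> (\<forall>u. L u \<bullet> x = L u \<bullet> y)"
proof -
  interpret linear L by fact
  define S where "S F = {a. \<exists>x\<in>E \<inter> F. dist (L a) x = infdist (L a) E}" for F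
  define T where "T e p q = S {x. L e \<bullet> x \<le> p} \<inter> S {x. L e \<bullet> x \<ge> q}" for e p q
  have "negligible (T e p q)" if "p < q" for e p q
  proof (rule negligible_closed_disjoint_translates[where e = e])
    have "closed (S F)" if "closed F" for F
      unfolding S_def using that assms
      by (intro closed_nearest_in_subset linear_continuous_on linear_conv_bounded_linear[THEN iffD1]) auto
    then show "closed (T e p q)"
      unfolding T_def by (simp add: closed_Int closed_halfspace_le closed_halfspace_ge)
  next
    fix a and t :: real assume "a \<in> T e p q" "t > 0"
    \<comment> \<open>Otherwise take \<open>x\<close> nearest to \<open>L a\<close> with
      \<open>L e \<bullet> x \<ge> q\<close> and \<open>y\<close> nearest to
      \<open>L a + t *\<^sub>R L e\<close> with \<open>L e \<bullet> y \<le> p\<close>; monotonicity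
      would give \<open>q \<le> p\<close>.\<close>
    then show "a + t *\<^sub>R e \<notin> T e p q"
      using inner_nearest_mono[of _ E "L a" _ t "L e"] \<open>p < q\<close>
      unfolding T_def S_def by (fastforce simp: add scale)
  qed
  then have "AE a in lebesgue. a \<notin> T e p q" if "p < q" for e p q
    using that AE_not_in negligible_iff_null_sets by blast
  \<comment> \<open>Only countably many null sets are discarded here.\<close>
  then have "AE a in lebesgue. \<forall>e\<in>Basis. \<forall>p\<in>\<rat>. \<forall>q\<in>\<rat>. p < q \<longrightarrow> a \<notin> T e p q"
    by (simp add: AE_ball_countable countable_rat countable_finite)
  then show ?thesis
  proof eventually_elim
    case (elim a)
    have *: "L e \<bullet> y \<le> L e \<bullet> x"
      if "x \<in> E" "y \<in> E" "dist (L a) x = infdist (L a) E" "dist (L a) y = infdist (L a) E"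
        "e \<in> Basis" for x y e
    proof (rule ccontr)
      assume "\<not> ?thesis"
      then obtain p where p: "p \<in> \<rat>" "L e \<bullet> x < p" "p < L e \<bullet> y"
        using Rats_dense_in_real[of "L e \<bullet> x" "L e \<bullet> y"] by auto
      then obtain q where "q \<in> \<rat>" "p < q" "q < L e \<bullet> y"
        using Rats_dense_in_real by blast
      with p have "a \<in> T e p q"
        unfolding T_def S_def using that by auto
      then show False using elim p \<open>q \<in> \<rat>\<close> \<open>p < q\<close> \<open>e \<in> Basis\<close> by blast
    qed
    show ?case
    proof (intro ballI impI allI)
      fix x y u
      assume xy: "x \<in> E" "y \<in> E" "dist (L a) x = infdist (L a) E" "dist (L a) y = infdist (L a) E"
      have "L u \<bullet> z = (\<Sum>e\<in>Basis. (u \<bullet> e) * (L e \<bullet> z))" for z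
        by (subst euclidean_representation[of u, symmetric]) (simp only: sum scale inner_sum_left inner_scaleR_left)
      moreover have "L e \<bullet> x = L e \<bullet> y" if "e \<in> Basis" for e
        using *[OF xy that] *[OF xy(2,1,4,3) that] by (rule order_antisym[rotated])
      ultimately show "L u \<bullet> x = L u \<bullet> y"
        by simp
    qed
  qed
qed

lemma AE_nearest_in_range_unique:
  fixes L :: "'a::euclidean_space \<Rightarrow> 'b::euclidean_space"
  assumes "linear L" "closed E"
  shows "AE a in lebesgue. \<forall>x\<in>E. \<forall>y\<in>E. dist (L a) x = infdist (L a) E \<longrightarrow>
           dist (L a) y = infdist (L a) E \<longrightarrow> x \<in> range L \<longrightarrow> y = x"
  using AE_nearest_inner_range_eq[OF assms]
proof eventually_elim
  case (elim a)
  show ?case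
  proof (intro ballI impI)
    fix x y
    assume xy: "x \<in> E" "y \<in> E" "dist (L a) x = infdist (L a) E" "dist (L a) y = infdist (L a) E"
      and "x \<in> range L"
    then obtain b where b: "x = L b" by blast
    \<comment> \<open>With \<open>x = L b\<close>, the residual \<open>L a - x\<close> is
      \<open>L (a - b)\<close>, again in the range, hence orthogonal to
      \<open>x - y\<close>.\<close>
    have "orthogonal (L (a - b)) (x - y)"
      using elim xy unfolding orthogonal_def inner_diff_right by (metis diff_self)
    then have "orthogonal (L a - x) (x - y)"
      by (simp add: b linear_diff[OF \<open>linear L\<close>])
    from norm_add_Pythagorean[OF this]
    have "(norm (L a - y))\<^sup>2 = (norm (L a - x))\<^sup>2 + (norm (x - y))\<^sup>2"
      by simp
    moreover have "norm (L a - y) = norm (L a - x)"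
      using xy by (simp add: dist_norm)
    ultimately show "y = x"
      by simp
  qed
qed

lemma nearest_matrix_iff_infdist:
  "nearest_matrix \<E> A B \<longleftrightarrow> B \<in> \<E> \<and> dist A B = infdist A \<E>"
proof
  assume "nearest_matrix \<E> A B"
  then have "B \<in> \<E>" and le: "\<And>X. X \<in> \<E> \<Longrightarrow> dist A B \<le> dist A X"
    by (auto simp: nearest_matrix_def frobenius_norm_eq_norm dist_norm)
  \<comment> \<open>\<open>infdist\<close> to the empty set is 0 by convention;
    \<open>B \<in> \<E>\<close> makes it a genuine infimum.\<close>
  then have "dist A B \<le> infdist A \<E>"
    unfolding infdist_def by (auto intro: cINF_greatest)
  then show "B \<in> \<E> \<and> dist A B = infdist A \<E>"
    using \<open>B \<in> \<E>\<close> infdist_le[of B \<E> A] by auto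
next
  assume "B \<in> \<E> \<and> dist A B = infdist A \<E>"
  then show "nearest_matrix \<E> A B"
    using infdist_le[of _ \<E> A]
    by (auto simp: nearest_matrix_def frobenius_norm_eq_norm dist_norm)
qed

lemma linear_map_matrix_of_real: "linear (map_matrix complex_of_real)"
  by (rule linearI) (simp_all add: vec_eq_iff scaleR_conv_of_real[where 'a = complex])

lemma real_matrix_iff_range: "real_matrix X \<longleftrightarrow> X \<in> range (map_matrix complex_of_real)"
proof
  assume "real_matrix X"
  then have "X = map_matrix complex_of_real (map_matrix Re X)"
    by (simp add: real_matrix_def vec_eq_iff)
  then show "X \<in> range (map_matrix complex_of_real)" by blast
qed (auto simp: real_matrix_def)

lemma map_matrix_cnj_eq_iff: "map_matrix cnj X = X \<longleftrightarrow> real_matrix X"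
  by (simp add: real_matrix_def vec_eq_iff Reals_cnj_iff)

text \<open>Conjugation is an isometry fixing real matrices, so it carries points nearest to a real
  matrix to equally near ones.\<close>

lemma frobenius_norm_real_diff_cnj:
  "frobenius_norm (map_matrix complex_of_real A - map_matrix cnj X)
     = frobenius_norm (map_matrix complex_of_real A - X)"
proof -
  have "cmod (complex_of_real r - cnj z) = cmod (complex_of_real r - z)" for r z
    by (metis complex_cnj_complex_of_real complex_cnj_diff complex_mod_cnj)
  then show ?thesis
    by (simp add: frobenius_norm_def)
qed

theorem theorem2p3:
  fixes \<E> :: "(complex^'n^'n) set"
  assumes "closed \<E>" and "\<E> \<noteq> {}"
  shows "AE A :: real^'n^'n in lebesgue.
      ((unique_nearest_real \<E> (map_matrix complex_of_real A) \<and>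
          \<not> all_nearest_nonreal \<E> (map_matrix complex_of_real A)) \<or>
       (\<not> unique_nearest_real \<E> (map_matrix complex_of_real A) \<and>
          all_nearest_nonreal \<E> (map_matrix complex_of_real A)))
      \<and> ((\<forall>X\<in>\<E>. map_matrix cnj X \<in> \<E>) \<and> (\<exists>X\<in>\<E>. real_matrix X) \<longrightarrow>
          all_nearest_nonreal \<E> (map_matrix complex_of_real A) \<longrightarrow>
          (\<exists>B C. B \<noteq> C \<and> nearest_matrix \<E> (map_matrix complex_of_real A) B
                       \<and> nearest_matrix \<E> (map_matrix complex_of_real A) C))"
  using AE_nearest_in_range_unique[OF linear_map_matrix_of_real \<open>closed \<E>\<close>]
proof eventually_elim
  case (elim A)
  let ?A = "map_matrix complex_of_real A"
  have unique: "C = B" if "nearest_matrix \<E> ?A B" "nearest_matrix \<E> ?A C" "real_matrix B" for B C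
    using elim that by (auto simp: nearest_matrix_iff_infdist real_matrix_iff_range)
  obtain N where N: "nearest_matrix \<E> ?A N"
    using infdist_attains_inf[OF assms] by (metis nearest_matrix_iff_infdist)
  \<comment> \<open>If not all nearest matrices are nonreal, some real one is nearest, and
    \<open>unique\<close> leaves no other.\<close>
  have "unique_nearest_real \<E> ?A \<longleftrightarrow> \<not> all_nearest_nonreal \<E> ?A"
    unfolding unique_nearest_real_def all_nearest_nonreal_def using unique by blast
  moreover have "\<exists>B C. B \<noteq> C \<and> nearest_matrix \<E> ?A B \<and> nearest_matrix \<E> ?A C"
    if "\<forall>X\<in>\<E>. map_matrix cnj X \<in> \<E>" "all_nearest_nonreal \<E> ?A"
  \<comment> \<open>The two matrices are \<open>N\<close> and its conjugate, which differ because
    \<open>N\<close> is nonreal.\<close>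
  proof (intro exI conjI)
    show "nearest_matrix \<E> ?A (map_matrix cnj N)"
      using N that(1) by (simp add: nearest_matrix_def frobenius_norm_real_diff_cnj)
    show "map_matrix cnj N \<noteq> N"
      using N that(2) by (simp add: all_nearest_nonreal_def map_matrix_cnj_eq_iff)
  qed (fact N)
  ultimately show ?case by blast
qed

end
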